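(* Let $\sigma\in\mathbb R\setminus\{0\}$, $\lambda>0$, $M\in\mathbb N$, $\vec k=(k_1,\dots,k_M)$ with all $k_j>0$. The function $D':X_c\times X_d\to\mathbb R$, $$D'(\vec x,\eta)=\prod_{j=1}^M\frac{\Gamma(k_j)}{\Gamma(k_j+\eta_j)}\left(\frac{\cosh_\sigma(\lambda+2E_j^-(\vec x))-\cosh_\sigma(\lambda+2E_{j-1}^-(\vec x))}{\sigma}\right)^{\eta_j},$$ is a duality function between $\mathrm{ABEP}_{\mathsf L}(\sigma,\vec k,\lambda)$ and $\mathrm{SIP}(\vec k)$: for all $\vec x\in X_c$ and $\eta\in X_d$, $$\big[L^{\mathrm{ABEP}_{\mathsf L}}_{\sigma,\vec k,\lambda}D'(\cdot,\eta)\big](\vec x)=\big[L^{\mathrm{SIP}}_{\vec k}D'(\vec x,\cdot)\big](\eta).$$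
   Context: $X_c=\mathbb R_{\ge0}^M$, $X_d=\mathbb Z_{\ge0}^M$; $\sinh_\sigma(x)=\sinh(\sigma x)$, $\cosh_\sigma(x)=\cosh(\sigma x)$; $E_j^-(\vec x)=\sum_{i=1}^jx_i$, $E_0^-=0$. Dynamic ABEP (left version) has generator $$[L^{\mathrm{ABEP}_{\mathsf L}}_{\sigma,\vec k,\lambda}f](\vec x)=\sum_{j=1}^{M-1}A_j\Big(\frac{\partial}{\partial x_j}-\frac{\partial}{\partial x_{j+1}}\Big)^2f(\vec x)+B_j\Big(\frac{\partial}{\partial x_j}-\frac{\partial}{\partial x_{j+1}}\Big)f(\vec x),$$ $$A_j=\frac1{\sigma^2}\sinh_\sigma(x_j)\sinh_\sigma(x_{j+1})\frac{\sinh_\sigma(\lambda+2E_j^--x_j)\sinh_\sigma(\lambda+2E_j^-+x_{j+1})}{\sinh_\sigma(\lambda+2E_j^-)^2},$$ $$B_j=\frac1\sigma\Big[k_j\sinh_\sigma(x_{j+1})\frac{\sinh_\sigma(\lambda+2E_j^-+x_{j+1})}{\sinh_\sigma(\lambda+2E_j^-)}-k_{j+1}\sinh_\sigma(x_j)\frac{\sinh_\sigma(\lambda+2E_j^--x_j)}{\sinh_\sigma(\lambda+2E_j^-)}$$ $$-2\sinh_\sigma(x_j)\sinh_\sigma(x_{j+1})\frac{\cosh_\sigma(\lambda+2E_j^-)\sinh_\sigma(\lambda+2E_j^--x_j)\sinh_\sigma(\lambda+2E_j^-+x_{j+1})}{\sinh_\sigma(\lambda+2E_j^-)^3}\Big].$$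 $\mathrm{SIP}(\vec k)$ (symmetric inclusion process) on $X_d$: $$[L^{\mathrm{SIP}}_{\vec k}f](\eta)=\sum_{j=1}^{M-1}\eta_j(\eta_{j+1}+k_{j+1})[f(\eta^{j,j+1})-f(\eta)]+\eta_{j+1}(\eta_j+k_j)[f(\eta^{j+1,j})-f(\eta)],$$ where $\eta^{j,m}$ is $\eta$ with one particle moved from $j$ to $m$ if $\eta_j\ge1$, else $\eta$. *)

theory Defs
  imports "HOL-Analysis.Analysis"
begin

text \<open>
  The sites are \<open>1, \<dots>, M\<close>. An \<open>M\<close>-tuple is a function on \<open>nat\<close> that is extensional on
  \<open>{1..M}\<close>, so that \<open>Xc M\<close> and \<open>Xd M\<close> are in bijection with the \<open>M\<close>-fold powers of the
  nonnegative reals and of the nonnegative integers.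
\<close>

definition Xc :: "nat \<Rightarrow> (nat \<Rightarrow> real) set" where
  "Xc M = {1..M} \<rightarrow>\<^sub>E {0..}"

definition Xd :: "nat \<Rightarrow> (nat \<Rightarrow> nat) set" where
  "Xd M = {1..M} \<rightarrow>\<^sub>E UNIV"

definition sinh_sc :: "real \<Rightarrow> real \<Rightarrow> real" where
  "sinh_sc \<sigma> x = sinh (\<sigma> * x)"

definition cosh_sc :: "real \<Rightarrow> real \<Rightarrow> real" where
  "cosh_sc \<sigma> x = cosh (\<sigma> * x)"

definition Eminus :: "nat \<Rightarrow> (nat \<Rightarrow> real) \<Rightarrow> real" where
  "Eminus j x = (\<Sum>i=1..j. x i)"

text \<open>
  The derivative is taken within the half-line \<open>{0..}\<close>: at \<open>x j > 0\<close> this is the usual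
  partial derivative, and on the face \<open>x j = 0\<close> it is the one-sided one. Hence on \<open>Xc M\<close> it
  depends only on the values of \<open>f\<close> on \<open>Xc M\<close>.
\<close>

definition partial_deriv :: "nat \<Rightarrow> ((nat \<Rightarrow> real) \<Rightarrow> real) \<Rightarrow> (nat \<Rightarrow> real) \<Rightarrow> real" where
  "partial_deriv j f x = vector_derivative (\<lambda>t. f (x(j := t))) (at (x j) within {0..})"

definition exch_deriv :: "nat \<Rightarrow> ((nat \<Rightarrow> real) \<Rightarrow> real) \<Rightarrow> (nat \<Rightarrow> real) \<Rightarrow> real" where
  "exch_deriv j f x = partial_deriv j f x - partial_deriv (j + 1) f x"

definition ABEP_A :: "real \<Rightarrow> real \<Rightarrow> nat \<Rightarrow> (nat \<Rightarrow> real) \<Rightarrow> real" where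
  "ABEP_A \<sigma> lam j x =
     1 / \<sigma>\<^sup>2 * sinh_sc \<sigma> (x j) * sinh_sc \<sigma> (x (j + 1)) *
     (sinh_sc \<sigma> (lam + 2 * Eminus j x - x j) * sinh_sc \<sigma> (lam + 2 * Eminus j x + x (j + 1))
       / (sinh_sc \<sigma> (lam + 2 * Eminus j x))\<^sup>2)"

definition ABEP_B ::
  "real \<Rightarrow> (nat \<Rightarrow> real) \<Rightarrow> real \<Rightarrow> nat \<Rightarrow> (nat \<Rightarrow> real) \<Rightarrow> real" where
  "ABEP_B \<sigma> k lam j x =
     1 / \<sigma> *
     (k j * sinh_sc \<sigma> (x (j + 1)) *
        (sinh_sc \<sigma> (lam + 2 * Eminus j x + x (j + 1)) / sinh_sc \<sigma> (lam + 2 * Eminus j x))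
      - k (j + 1) * sinh_sc \<sigma> (x j) *
        (sinh_sc \<sigma> (lam + 2 * Eminus j x - x j) / sinh_sc \<sigma> (lam + 2 * Eminus j x))
      - 2 * sinh_sc \<sigma> (x j) * sinh_sc \<sigma> (x (j + 1)) *
        (cosh_sc \<sigma> (lam + 2 * Eminus j x) * sinh_sc \<sigma> (lam + 2 * Eminus j x - x j)
           * sinh_sc \<sigma> (lam + 2 * Eminus j x + x (j + 1))
         / (sinh_sc \<sigma> (lam + 2 * Eminus j x)) ^ 3))"

definition L_ABEP ::
  "nat \<Rightarrow> real \<Rightarrow> (nat \<Rightarrow> real) \<Rightarrow> real \<Rightarrow> ((nat \<Rightarrow> real) \<Rightarrow> real) \<Rightarrow> (nat \<Rightarrow> real) \<Rightarrow> real" where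
  "L_ABEP M \<sigma> k lam f x =
     (\<Sum>j=1..M-1. ABEP_A \<sigma> lam j x * exch_deriv j (exch_deriv j f) x
                  + ABEP_B \<sigma> k lam j x * exch_deriv j f x)"

definition move :: "nat \<Rightarrow> nat \<Rightarrow> (nat \<Rightarrow> nat) \<Rightarrow> (nat \<Rightarrow> nat)" where
  "move j m \<eta> = (if \<eta> j \<ge> 1 then \<eta>(j := \<eta> j - 1, m := \<eta> m + 1) else \<eta>)"

definition L_SIP ::
  "nat \<Rightarrow> (nat \<Rightarrow> real) \<Rightarrow> ((nat \<Rightarrow> nat) \<Rightarrow> real) \<Rightarrow> (nat \<Rightarrow> nat) \<Rightarrow> real" where
  "L_SIP M k f \<eta> =
     (\<Sum>j=1..M-1. real (\<eta> j) * (real (\<eta> (j + 1)) + k (j + 1)) * (f (move j (j + 1) \<eta>) - f \<eta>)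
                  + real (\<eta> (j + 1)) * (real (\<eta> j) + k j) * (f (move (j + 1) j \<eta>) - f \<eta>))"

definition D' ::
  "nat \<Rightarrow> real \<Rightarrow> (nat \<Rightarrow> real) \<Rightarrow> real \<Rightarrow> (nat \<Rightarrow> real) \<Rightarrow> (nat \<Rightarrow> nat) \<Rightarrow> real" where
  "D' M \<sigma> k lam x \<eta> =
     (\<Prod>j=1..M. Gamma (k j) / Gamma (k j + real (\<eta> j)) *
        ((cosh_sc \<sigma> (lam + 2 * Eminus j x) - cosh_sc \<sigma> (lam + 2 * Eminus (j - 1) x)) / \<sigma>) ^ \<eta> j)"

end

theory Submission
  imports Defs
begin

text \<open>
  Put \<open>z\<^sub>j = (cosh \<sigma>(\<lambda> + 2E\<^sub>j) - cosh \<sigma>(\<lambda> + 2E\<^sub>j\<^sub>-\<^sub>1)) / \<sigma>\<close>. The field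
  \<open>\<partial>\<^sub>j - \<partial>\<^sub>j\<^sub>+\<^sub>1\<close> kills every \<open>E\<^sub>i\<close> except \<open>E\<^sub>j\<close>, so in the new coordinates it is
  \<open>2 sinh \<sigma>(\<lambda> + 2E\<^sub>j)\<close> times \<open>\<partial>/\<partial>z\<^sub>j - \<partial>/\<partial>z\<^sub>j\<^sub>+\<^sub>1\<close>. The last term of \<open>B\<^sub>j\<close> cancels the
  first-order term created by squaring the field, and each bond of the generator becomes
  \<open>z\<^sub>j z\<^sub>j\<^sub>+\<^sub>1 (\<partial>/\<partial>z\<^sub>j - \<partial>/\<partial>z\<^sub>j\<^sub>+\<^sub>1)\<^sup>2 + (k\<^sub>j z\<^sub>j\<^sub>+\<^sub>1 - k\<^sub>j\<^sub>+\<^sub>1 z\<^sub>j) (\<partial>/\<partial>z\<^sub>j - \<partial>/\<partial>z\<^sub>j\<^sub>+\<^sub>1)\<close>,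
  the Brownian energy process, whose action on weighted monomials is that of the inclusion process.
\<close>

section \<open>Calculus of the field \<partial>_j - \<partial>_(j+1) on the half-line\<close>

text \<open>\<open>exch_deriv\<close> is a choice value and carries no proof of differentiability.
  The relational form records that both within-derivatives exist, so sum, product and chain rules
  compose.\<close>

definition has_exch_deriv :: "nat \<Rightarrow> ((nat \<Rightarrow> real) \<Rightarrow> real) \<Rightarrow> real \<Rightarrow> (nat \<Rightarrow> real) \<Rightarrow> bool" where
  "has_exch_deriv j f d x \<longleftrightarrow>
     (\<exists>a b. ((\<lambda>t. f (x(j := t))) has_real_derivative a) (at (x j) within {0..}) \<and>
            ((\<lambda>t. f (x(j + 1 := t))) has_real_derivative b) (at (x (j + 1)) within {0..}) \<and>
            d = a - b)"

lemma partial_deriv_eqI: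
  assumes "((\<lambda>t. f (x(j := t))) has_real_derivative a) (at (x j) within {0..})" and "x j \<ge> 0"
  shows "partial_deriv j f x = a"
proof -
  \<comment> \<open>A connected set that is no singleton has only limit points. This covers the
    boundary point 0 as well and makes the derivative within \<open>{0..}\<close> unique.\<close>
  have "{0::real..} \<noteq> {b}" for b
    by (metis atLeast_iff infinite_Ici finite.emptyI finite_insert)
  then have "x j islimpt {0..}"
    using assms(2) by (intro connected_imp_perfect) auto
  then have "at (x j) within {0..} \<noteq> bot"
    by (simp add: trivial_limit_within)
  then show ?thesis
    using assms(1) unfolding partial_deriv_def
    by (intro vector_derivative_within) (simp_all add: has_real_derivative_iff_has_vector_derivative)
qed

lemma exch_deriv_eqI:
  assumes "has_exch_deriv j f d x" and "x j \<ge> 0" and "x (j + 1) \<ge> 0"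
  shows "exch_deriv j f x = d"
  using assms partial_deriv_eqI unfolding has_exch_deriv_def exch_deriv_def by blast

text \<open>Meant for second derivatives: a closed form of the first derivative is known only where
  coordinates \<open>j\<close> and \<open>j + 1\<close> are nonnegative. Derivatives within
  \<open>{0..}\<close> look at no other points.\<close>

lemma has_exch_deriv_transform:
  assumes "has_exch_deriv j f d x" and "x j \<ge> 0" and "x (j + 1) \<ge> 0"
    and "\<And>y. \<lbrakk>y j \<ge> 0; y (j + 1) \<ge> 0; \<And>i. i \<notin> {j, j + 1} \<Longrightarrow> y i = x i\<rbrakk> \<Longrightarrow> g y = f y"
  shows "has_exch_deriv j g d x"
proof -
  obtain a b where
    a: "((\<lambda>t. f (x(j := t))) has_real_derivative a) (at (x j) within {0..})" and
    b: "((\<lambda>t. f (x(j + 1 := t))) has_real_derivative b) (at (x (j + 1)) within {0..})" and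
    "d = a - b"
    using assms(1) unfolding has_exch_deriv_def by blast
  moreover have "((\<lambda>t. g (x(j := t))) has_real_derivative a) (at (x j) within {0..})"
    \<comment> \<open>The radius 1 is arbitrary, as \<open>f\<close> and \<open>g\<close> agree
      along the whole half-line.\<close>
    by (rule has_field_derivative_transform_within[OF a, of 1]) (use assms in auto)
  moreover have "((\<lambda>t. g (x(j + 1 := t))) has_real_derivative b) (at (x (j + 1)) within {0..})"
    by (rule has_field_derivative_transform_within[OF b, of 1]) (use assms in auto)
  ultimately show ?thesis
    unfolding has_exch_deriv_def by blast
qed

lemma has_exch_deriv_eq_rhs:
  "has_exch_deriv j f d x \<Longrightarrow> d = e \<Longrightarrow> has_exch_deriv j f e x"
  by simp

lemma has_exch_deriv_const: "has_exch_deriv j (\<lambda>y. c) 0 x"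
  unfolding has_exch_deriv_def by (intro exI[of _ 0]) auto

lemma has_exch_deriv_diff:
  assumes "has_exch_deriv j f d x" and "has_exch_deriv j g e x"
  shows "has_exch_deriv j (\<lambda>y. f y - g y) (d - e) x"
proof -
  obtain a b a' b' where
    "((\<lambda>t. f (x(j := t))) has_real_derivative a) (at (x j) within {0..})"
    "((\<lambda>t. f (x(j + 1 := t))) has_real_derivative b) (at (x (j + 1)) within {0..})"
    "((\<lambda>t. g (x(j := t))) has_real_derivative a') (at (x j) within {0..})"
    "((\<lambda>t. g (x(j + 1 := t))) has_real_derivative b') (at (x (j + 1)) within {0..})"
    "d = a - b" "e = a' - b'"
    using assms unfolding has_exch_deriv_def by blast
  then show ?thesis
    unfolding has_exch_deriv_def
    by (intro exI[of _ "a - a'"] exI[of _ "b - b'"]) (auto intro: DERIV_diff)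
qed

lemma has_exch_deriv_mult:
  assumes "has_exch_deriv j f d x" and "has_exch_deriv j g e x"
  shows "has_exch_deriv j (\<lambda>y. f y * g y) (d * g x + f x * e) x"
proof -
  obtain a b a' b' where
    "((\<lambda>t. f (x(j := t))) has_real_derivative a) (at (x j) within {0..})"
    "((\<lambda>t. f (x(j + 1 := t))) has_real_derivative b) (at (x (j + 1)) within {0..})"
    "((\<lambda>t. g (x(j := t))) has_real_derivative a') (at (x j) within {0..})"
    "((\<lambda>t. g (x(j + 1 := t))) has_real_derivative b') (at (x (j + 1)) within {0..})"
    and de: "d = a - b" "e = a' - b'"
    using assms unfolding has_exch_deriv_def by blast
  note 1 = DERIV_mult[OF this(1,3)] and 2 = DERIV_mult[OF this(2,4)]
  show ?thesis
    unfolding has_exch_deriv_def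
    by (rule exI, rule exI, rule conjI[OF 1 conjI[OF 2]]) (simp add: de algebra_simps)
qed

lemma has_exch_deriv_chain:
  assumes "has_exch_deriv j f d x" and "(h has_real_derivative D) (at (f x))"
  shows "has_exch_deriv j (\<lambda>y. h (f y)) (D * d) x"
proof -
  obtain a b where
    "((\<lambda>t. f (x(j := t))) has_real_derivative a) (at (x j) within {0..})"
    "((\<lambda>t. f (x(j + 1 := t))) has_real_derivative b) (at (x (j + 1)) within {0..})"
    and d: "d = a - b"
    using assms(1) unfolding has_exch_deriv_def by blast
  note 1 = DERIV_chain2[OF _ this(1), of h D] and 2 = DERIV_chain2[OF _ this(2), of h D]
  show ?thesis
    unfolding has_exch_deriv_def
    by (rule exI, rule exI, rule conjI[OF 1 conjI[OF 2]])
       (use assms(2) in \<open>simp_all add: d algebra_simps\<close>)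
qed

lemma has_exch_deriv_cmult:
  "has_exch_deriv j f d x \<Longrightarrow> has_exch_deriv j (\<lambda>y. c * f y) (c * d) x"
  using has_exch_deriv_mult[OF has_exch_deriv_const, of j f d x c] by simp

lemma has_exch_deriv_prod_zero:
  assumes "\<And>i. i \<in> I \<Longrightarrow> has_exch_deriv j (f i) 0 x"
  shows "has_exch_deriv j (\<lambda>y. \<Prod>i\<in>I. f i y) 0 x"
  using assms
proof (induction I rule: infinite_finite_induct)
  case (insert i I)
  then show ?case
    using has_exch_deriv_mult[of j "f i" 0 x "\<lambda>y. \<Prod>i\<in>I. f i y" 0] by simp
qed (simp_all add: has_exch_deriv_const)

lemma Eminus_upd:
  "Eminus i (x(j := t)) = Eminus i x + (if j \<in> {1..i} then t - x j else 0)"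
proof (cases "j \<in> {1..i}")
  case True
  then have "Eminus i y = y j + (\<Sum>l\<in>{1..i} - {j}. y l)" for y
    unfolding Eminus_def by (intro sum.remove) auto
  moreover have "(\<Sum>l\<in>{1..i} - {j}. (x(j := t)) l) = (\<Sum>l\<in>{1..i} - {j}. x l)"
    by (rule sum.cong) auto
  ultimately show ?thesis
    using True by simp
next
  case False
  then show ?thesis
    unfolding Eminus_def by (auto intro: sum.cong)
qed

text \<open>For i > j both coordinates enter E_i with slope 1, for i < j neither enters; the
  difference survives only at i = j.\<close>

lemma has_exch_deriv_Eminus:
  assumes "j \<ge> 1"
  shows "has_exch_deriv j (Eminus i) (if i = j then 1 else 0) x"
proof -
  have "((\<lambda>t. Eminus i (x(l := t))) has_real_derivative (if l \<in> {1..i} then 1 else 0))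
          (at (x l) within {0..})" for l
    unfolding Eminus_upd by (auto intro!: derivative_eq_intros)
  note E = this
  have "(if i = j then 1 else 0 :: real) =
      (if j \<in> {1..i} then 1 else 0) - (if j + 1 \<in> {1..i} then 1 else 0)"
    using assms by simp
  with E[of j] E[of "j + 1"] show ?thesis
    unfolding has_exch_deriv_def by blast
qed

section \<open>Energy coordinates and the factors of \<open>D'\<close>\<close>

definition energy :: "real \<Rightarrow> real \<Rightarrow> nat \<Rightarrow> (nat \<Rightarrow> real) \<Rightarrow> real" where
  "energy \<sigma> lam i y =
     (cosh_sc \<sigma> (lam + 2 * Eminus i y) - cosh_sc \<sigma> (lam + 2 * Eminus (i - 1) y)) / \<sigma>"

definition site_weight :: "real \<Rightarrow> nat \<Rightarrow> real" where
  "site_weight \<kappa> n = Gamma \<kappa> / Gamma (\<kappa> + real n)"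

text \<open>This is the functional equation of Gamma, stated without division so that it can absorb
  a jump rate later.\<close>

lemma site_weight_Suc:
  assumes "\<kappa> > 0"
  shows "site_weight \<kappa> n = (\<kappa> + real n) * site_weight \<kappa> (Suc n)"
proof -
  have "Gamma (\<kappa> + real n + 1) = (\<kappa> + real n) * Gamma (\<kappa> + real n)"
    using assms by (intro Gamma_plus1) (auto elim!: nonpos_Ints_cases)
  moreover have "\<kappa> + real n \<noteq> 0"
    using assms by (simp add: add_pos_nonneg pos_add_strict less_imp_neq[symmetric])
  ultimately show ?thesis
    by (simp add: site_weight_def add_ac)
qed

lemma site_weight_pred:
  assumes "\<kappa> > 0" and "n \<ge> 1"
  shows "site_weight \<kappa> (n - 1) = (\<kappa> + real n - 1) * site_weight \<kappa> n"
  using site_weight_Suc[OF assms(1), of "n - 1"] assms(2) by (simp add: of_nat_diff)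

lemma D'_eq: "D' M \<sigma> k lam x \<eta> = (\<Prod>i=1..M. site_weight (k i) (\<eta> i) * energy \<sigma> lam i x ^ \<eta> i)"
  by (simp add: D'_def site_weight_def energy_def)

text \<open>The part of \<open>D'\<close> that neither dynamics on the bond (j, j + 1) can
  change.\<close>

definition off_bond ::
  "nat \<Rightarrow> nat \<Rightarrow> real \<Rightarrow> (nat \<Rightarrow> real) \<Rightarrow> real \<Rightarrow> (nat \<Rightarrow> real) \<Rightarrow> (nat \<Rightarrow> nat) \<Rightarrow> real" where
  "off_bond j M \<sigma> k lam x \<eta> =
     (\<Prod>i\<in>{1..M} - {j, j + 1}. site_weight (k i) (\<eta> i) * energy \<sigma> lam i x ^ \<eta> i)"

lemma D'_split:
  assumes "j \<in> {1..M - 1}"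
  shows "D' M \<sigma> k lam x \<eta> = off_bond j M \<sigma> k lam x \<eta> *
     (site_weight (k j) (\<eta> j) * site_weight (k (j + 1)) (\<eta> (j + 1))) *
     (energy \<sigma> lam j x ^ \<eta> j * energy \<sigma> lam (j + 1) x ^ \<eta> (j + 1))"
proof -
  have eq: "{1..M} = insert j (insert (j + 1) ({1..M} - {j, j + 1}))"
    using assms by auto
  show ?thesis
    unfolding D'_eq off_bond_def by (subst eq, subst prod.insert, simp, simp, subst prod.insert) simp_all
qed

section \<open>First and second exchange derivatives on one bond\<close>

lemma has_exch_deriv_cosh_Eminus:
  assumes "j \<ge> 1"
  shows "has_exch_deriv j (\<lambda>y. cosh_sc \<sigma> (lam + 2 * Eminus i y))
           (if i = j then 2 * \<sigma> * sinh_sc \<sigma> (lam + 2 * Eminus j x) else 0) x"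
proof -
  have "((\<lambda>e. cosh_sc \<sigma> (lam + 2 * e)) has_real_derivative 2 * \<sigma> * sinh_sc \<sigma> (lam + 2 * e))
          (at e)" for e
    unfolding cosh_sc_def sinh_sc_def by (auto intro!: derivative_eq_intros)
  from has_exch_deriv_chain[OF has_exch_deriv_Eminus[OF assms, of i x] this] show ?thesis
    by (auto split: if_splits)
qed

lemma has_exch_deriv_sinh_Eminus:
  assumes "j \<ge> 1"
  shows "has_exch_deriv j (\<lambda>y. sinh_sc \<sigma> (lam + 2 * Eminus j y))
           (2 * \<sigma> * cosh_sc \<sigma> (lam + 2 * Eminus j x)) x"
proof -
  have "((\<lambda>e. sinh_sc \<sigma> (lam + 2 * e)) has_real_derivative 2 * \<sigma> * cosh_sc \<sigma> (lam + 2 * e))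
          (at e)" for e
    unfolding cosh_sc_def sinh_sc_def by (auto intro!: derivative_eq_intros)
  from has_exch_deriv_chain[OF has_exch_deriv_Eminus[OF assms, of j x] this] show ?thesis
    by simp
qed

lemma has_exch_deriv_energy:
  assumes "j \<ge> 1" and "\<sigma> \<noteq> 0"
  shows "has_exch_deriv j (energy \<sigma> lam i)
           ((if i = j then 1 else if i = j + 1 then -1 else 0)
             * (2 * sinh_sc \<sigma> (lam + 2 * Eminus j x))) x"
proof -
  note d = has_exch_deriv_diff[OF has_exch_deriv_cosh_Eminus[OF assms(1), of \<sigma> lam i x]
      has_exch_deriv_cosh_Eminus[OF assms(1), of \<sigma> lam "i - 1" x]]
  have "has_exch_deriv j (energy \<sigma> lam i)
     (1 / \<sigma> * ((if i = j then 2 * \<sigma> * sinh_sc \<sigma> (lam + 2 * Eminus j x) else 0) -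
               (if i - 1 = j then 2 * \<sigma> * sinh_sc \<sigma> (lam + 2 * Eminus j x) else 0))) x"
    using has_exch_deriv_cmult[OF d, of "1 / \<sigma>"] by (simp add: energy_def[abs_def])
  then show ?thesis
    \<comment> \<open>Despite truncated subtraction, \<open>i - 1 = j\<close> amounts to
      \<open>i = j + 1\<close>, because \<open>j \<ge> 1\<close>.\<close>
    using assms by (auto split: if_splits simp: field_simps)
qed

lemma has_exch_deriv_energy_power:
  assumes "j \<ge> 1" and "\<sigma> \<noteq> 0"
  shows "has_exch_deriv j (\<lambda>y. energy \<sigma> lam i y ^ n)
           (real n * energy \<sigma> lam i x ^ (n - 1) *
             ((if i = j then 1 else if i = j + 1 then -1 else 0)
               * (2 * sinh_sc \<sigma> (lam + 2 * Eminus j x)))) x"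
  by (rule has_exch_deriv_chain[OF has_exch_deriv_energy[OF assms]])
     (auto intro!: derivative_eq_intros)

lemma has_exch_deriv_off_bond:
  assumes "j \<ge> 1" and "\<sigma> \<noteq> 0"
  shows "has_exch_deriv j (\<lambda>y. off_bond j M \<sigma> k lam y \<eta>) 0 x"
  unfolding off_bond_def
proof (intro has_exch_deriv_prod_zero)
  fix i
  assume "i \<in> {1..M} - {j, j + 1}"
  then show "has_exch_deriv j (\<lambda>y. site_weight (k i) (\<eta> i) * energy \<sigma> lam i y ^ \<eta> i) 0 x"
    using has_exch_deriv_cmult[OF has_exch_deriv_energy_power[OF assms, of lam i "\<eta> i" x],
        of "site_weight (k i) (\<eta> i)"] by simp
qed

text \<open>\<open>T\<close> is left general so that it can also absorb the numerical coefficients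
  that appear when differentiating a second time. Truncated exponents such as \<open>n - 1\<close>
  at \<open>n = 0\<close> are harmless: they come with the factor \<open>n\<close>.\<close>

lemma has_exch_deriv_bond:
  fixes lam :: real and n m :: nat
  assumes "j \<ge> 1" and "\<sigma> \<noteq> 0" and "has_exch_deriv j T 0 x"
  defines "z \<equiv> energy \<sigma> lam j" and "w \<equiv> energy \<sigma> lam (j + 1)"
  shows "has_exch_deriv j (\<lambda>y. T y * (z y ^ n * w y ^ m))
           (2 * sinh_sc \<sigma> (lam + 2 * Eminus j x) * T x *
             (real n * z x ^ (n - 1) * w x ^ m - real m * z x ^ n * w x ^ (m - 1))) x"
  unfolding z_def w_def
  by (rule has_exch_deriv_eq_rhs[OF has_exch_deriv_mult[OF assms(3) has_exch_deriv_mult[OF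
          has_exch_deriv_energy_power[OF assms(1,2)] has_exch_deriv_energy_power[OF assms(1,2)]]]])
     (simp add: right_diff_distrib mult_ac)

text \<open>The first derivative is 2 \<open>S\<close> times a difference of monomials of the same
  shape. Differentiating \<open>S\<close> yields the cosh term; differentiating the monomials yields
  the \<open>S\<close>-squared term.\<close>

lemma exch_deriv_bond2:
  fixes lam :: real and n m :: nat
  assumes "j \<ge> 1" and "\<sigma> \<noteq> 0" and "x j \<ge> 0" and "x (j + 1) \<ge> 0"
    and T: "\<And>y. has_exch_deriv j T 0 y"
  defines "z \<equiv> energy \<sigma> lam j" and "w \<equiv> energy \<sigma> lam (j + 1)"
    and "S \<equiv> \<lambda>y. sinh_sc \<sigma> (lam + 2 * Eminus j y)"
  shows "exch_deriv j (exch_deriv j (\<lambda>y. T y * (z y ^ n * w y ^ m))) x =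
     4 * \<sigma> * cosh_sc \<sigma> (lam + 2 * Eminus j x) * T x *
       (real n * z x ^ (n - 1) * w x ^ m - real m * z x ^ n * w x ^ (m - 1)) +
     4 * (S x)\<^sup>2 * T x *
       (real n * real (n - 1) * z x ^ (n - 2) * w x ^ m
        - 2 * real n * real m * z x ^ (n - 1) * w x ^ (m - 1)
        + real m * real (m - 1) * z x ^ n * w x ^ (m - 2))"
proof -
  note bond = has_exch_deriv_bond[OF assms(1,2) T, where lam = lam, folded z_def w_def]
  \<comment> \<open>\<open>G\<close> is a monomial with coefficient \<open>c\<close>; regrouped as
    \<open>T y * c\<close> times powers it falls under the first-derivative lemma again.\<close>
  define G where "G c p q y = T y * (c * (z y ^ p * w y ^ q))" for c p q y
  have cT: "has_exch_deriv j (\<lambda>y. T y * c) 0 y" for c y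
    using has_exch_deriv_mult[OF T[of y] has_exch_deriv_const[of j c y]] by simp
  have G: "has_exch_deriv j (G c p q) (2 * S x * T x * c *
     (real p * z x ^ (p - 1) * w x ^ q - real q * z x ^ p * w x ^ (q - 1))) x" for c p q
    using has_exch_deriv_bond[OF assms(1,2) cT[of c x], where lam = lam and n = p and m = q]
    by (simp add: G_def[abs_def] z_def w_def S_def mult.assoc)
  \<comment> \<open>The formula is needed at all nearby admissible points, not only at
    \<open>x\<close>, since it is differentiated next.\<close>
  have inner: "exch_deriv j (\<lambda>y. T y * (z y ^ n * w y ^ m)) y =
      2 * (S y * (G (real n) (n - 1) m y - G (real m) n (m - 1) y))"
    if "y j \<ge> 0" "y (j + 1) \<ge> 0" for y
    by (subst exch_deriv_eqI[OF bond that]) (simp add: G_def S_def algebra_simps)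
  have S: "has_exch_deriv j S (2 * \<sigma> * cosh_sc \<sigma> (lam + 2 * Eminus j x)) x"
    unfolding S_def by (rule has_exch_deriv_sinh_Eminus[OF assms(1)])
  note D = has_exch_deriv_cmult[OF has_exch_deriv_mult[OF S
        has_exch_deriv_diff[OF G[of "real n" "n - 1" m] G[of "real m" n "m - 1"]]], of 2]
  note exch_deriv_eqI[OF has_exch_deriv_transform[OF D assms(3,4) inner] assms(3,4)]
  moreover have "n - 1 - 1 = n - 2" "m - 1 - 1 = m - 2"
    by simp_all
  ultimately show ?thesis
    by (simp add: G_def power2_eq_square algebra_simps)
qed

section \<open>Algebraic identities on one bond\<close>

text \<open>This is the duality of the Brownian energy process and the inclusion process on one
  bond, with the Gamma weights already turned into the factors k + n - 1 and l + m - 1. The left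
  side is the differential operator applied to z^n w^m.\<close>

lemma BEP_SIP_bond:
  fixes z w k l :: real and n m :: nat
  shows "z * w * (real n * real (n - 1) * z ^ (n - 2) * w ^ m
           - 2 * real n * real m * z ^ (n - 1) * w ^ (m - 1)
           + real m * real (m - 1) * z ^ n * w ^ (m - 2))
       + (k * w - l * z) * (real n * z ^ (n - 1) * w ^ m - real m * z ^ n * w ^ (m - 1))
     = real n * ((k + real n - 1) * (z ^ (n - 1) * w ^ (m + 1)) - (real m + l) * (z ^ n * w ^ m))
       + real m * ((l + real m - 1) * (z ^ (n + 1) * w ^ (m - 1)) - (real n + k) * (z ^ n * w ^ m))"
proof -
  \<comment> \<open>Multiplying by \<open>u\<close> restores the exponent; where subtraction
    truncates, the prefactor is 0.\<close>
  have 1: "real p * u ^ (p - 1) * u = real p * u ^ p"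
    and 2: "real p * real (p - 1) * u ^ (p - 2) * u = (real p - 1) * (real p * u ^ (p - 1))"
    for p and u :: real
    by (cases p; cases "p - 1"; simp)+
  \<comment> \<open>These are the first and second derivatives of z^n and w^m. Kept as atoms, they
    satisfy the relations \<open>eqs\<close>, and only ring arithmetic remains.\<close>
  define P1 P2 Q1 Q2 where "P1 = real n * z ^ (n - 1)" "P2 = real n * real (n - 1) * z ^ (n - 2)"
    "Q1 = real m * w ^ (m - 1)" "Q2 = real m * real (m - 1) * w ^ (m - 2)"
  note defs = this
  have eqs: "P1 * z = real n * z ^ n" "Q1 * w = real m * w ^ m"
    "P2 * z = (real n - 1) * P1" "Q2 * w = (real m - 1) * Q1"
    unfolding defs by (rule 1 2)+
  have "z * w * (P2 * w ^ m - 2 * P1 * Q1 + z ^ n * Q2) + (k * w - l * z) * (P1 * w ^ m - z ^ n * Q1)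
      = (P2 * z) * w * w ^ m - 2 * (P1 * z) * (Q1 * w) + (Q2 * w) * z * z ^ n
        + k * w * P1 * w ^ m - k * z ^ n * (Q1 * w) - l * (P1 * z) * w ^ m + l * z * z ^ n * Q1"
    by (simp add: algebra_simps)
  also have "\<dots> = (k + real n - 1) * P1 * w * w ^ m + (l + real m - 1) * Q1 * z * z ^ n
      - (2 * real n * real m + k * real m + l * real n) * (z ^ n * w ^ m)"
    unfolding eqs by (simp add: algebra_simps)
  finally show ?thesis
    unfolding defs by (simp add: algebra_simps)
qed

text \<open>A difference of cosh values is 2 sinh(midpoint) sinh(half-distance). Writing both
  midpoints through E_j produces exactly the sinh factors of A_j and B_j.\<close>

lemma energy_eq:
  assumes "j \<ge> 1"
  shows "energy \<sigma> lam j x = 2 / \<sigma> * sinh_sc \<sigma> (x j) * sinh_sc \<sigma> (lam + 2 * Eminus j x - x j)"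
    and "energy \<sigma> lam (j + 1) x =
      2 / \<sigma> * sinh_sc \<sigma> (x (j + 1)) * sinh_sc \<sigma> (lam + 2 * Eminus j x + x (j + 1))"
proof -
  have cosh_diff: "cosh (a + b) - cosh (a - b) = 2 * sinh b * sinh a" for a b :: real
    by (simp add: cosh_add cosh_diff)
  have "Eminus j x = Eminus (j - 1) x + x j"
    using assms by (cases j) (auto simp: Eminus_def)
  then show "energy \<sigma> lam j x =
      2 / \<sigma> * sinh_sc \<sigma> (x j) * sinh_sc \<sigma> (lam + 2 * Eminus j x - x j)"
    using cosh_diff[of "\<sigma> * (lam + 2 * Eminus j x - x j)" "\<sigma> * x j"]
    by (simp add: energy_def cosh_sc_def sinh_sc_def algebra_simps)
  show "energy \<sigma> lam (j + 1) x =
      2 / \<sigma> * sinh_sc \<sigma> (x (j + 1)) * sinh_sc \<sigma> (lam + 2 * Eminus j x + x (j + 1))"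
    using cosh_diff[of "\<sigma> * (lam + 2 * Eminus j x + x (j + 1))" "\<sigma> * x (j + 1)"]
    by (simp add: energy_def cosh_sc_def sinh_sc_def Eminus_def algebra_simps)
qed

text \<open>After factoring the energies, the cubic-denominator term of B_j times 2 \<open>S\<close>
  equals -4 \<sigma> \<open>C\<close> A_j, so it cancels; the two remaining terms give the linear
  drift.\<close>

lemma ABEP_coeffs_energy:
  fixes lam :: real and x :: "nat \<Rightarrow> real"
  assumes "j \<ge> 1" and "\<sigma> \<noteq> 0"
  defines "S \<equiv> sinh_sc \<sigma> (lam + 2 * Eminus j x)" and "C \<equiv> cosh_sc \<sigma> (lam + 2 * Eminus j x)"
    and "z \<equiv> energy \<sigma> lam j x" and "w \<equiv> energy \<sigma> lam (j + 1) x"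
  assumes "S \<noteq> 0"
  shows "4 * S\<^sup>2 * ABEP_A \<sigma> lam j x = z * w"
    and "4 * \<sigma> * C * ABEP_A \<sigma> lam j x + 2 * S * ABEP_B \<sigma> k lam j x = k j * w - k (j + 1) * z"
proof -
  note e = energy_eq[OF assms(1), of \<sigma> lam x]
  show "4 * S\<^sup>2 * ABEP_A \<sigma> lam j x = z * w"
    unfolding ABEP_A_def z_def w_def e S_def[symmetric]
    using assms(2,7) by (simp add: field_simps power2_eq_square)
  show "4 * \<sigma> * C * ABEP_A \<sigma> lam j x + 2 * S * ABEP_B \<sigma> k lam j x = k j * w - k (j + 1) * z"
    unfolding ABEP_A_def ABEP_B_def z_def w_def e S_def[symmetric] C_def[symmetric]
    using assms(2,7) by (simp add: field_simps power2_eq_square power3_eq_cube)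
qed

text \<open>Removing a particle multiplies the weight of its site by k + n - 1. Adding one divides
  the weight of the target site by k + m, which cancels against the same factor in the jump
  rate.\<close>

lemma SIP_bond:
  fixes \<sigma> lam :: real and k x :: "nat \<Rightarrow> real" and \<eta> :: "nat \<Rightarrow> nat"
  assumes "j \<in> {1..M - 1}" and "k j > 0" and "k (j + 1) > 0"
  defines "z \<equiv> energy \<sigma> lam j x" and "w \<equiv> energy \<sigma> lam (j + 1) x"
    and "n \<equiv> \<eta> j" and "m \<equiv> \<eta> (j + 1)"
  defines "c \<equiv> off_bond j M \<sigma> k lam x \<eta> * (site_weight (k j) n * site_weight (k (j + 1)) m)"
  shows "real n * (real m + k (j + 1)) * (D' M \<sigma> k lam x (move j (j + 1) \<eta>) - D' M \<sigma> k lam x \<eta>) =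
      c * (real n * ((k j + real n - 1) * (z ^ (n - 1) * w ^ (m + 1))
                     - (real m + k (j + 1)) * (z ^ n * w ^ m)))"
    and "real m * (real n + k j) * (D' M \<sigma> k lam x (move (j + 1) j \<eta>) - D' M \<sigma> k lam x \<eta>) =
      c * (real m * ((k (j + 1) + real m - 1) * (z ^ (n + 1) * w ^ (m - 1))
                     - (real n + k j) * (z ^ n * w ^ m)))"
proof -
  note split = D'_split[OF assms(1), of \<sigma> k lam x]
  have off: "off_bond j M \<sigma> k lam x \<xi> = off_bond j M \<sigma> k lam x \<eta>"
    if "\<And>i. i \<notin> {j, j + 1} \<Longrightarrow> \<xi> i = \<eta> i" for \<xi>
    using that unfolding off_bond_def by (auto intro!: prod.cong)
  have D: "D' M \<sigma> k lam x \<eta> = c * (z ^ n * w ^ m)"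
    unfolding split by (simp add: c_def z_def w_def n_def m_def)
  show "real n * (real m + k (j + 1)) *
      (D' M \<sigma> k lam x (move j (j + 1) \<eta>) - D' M \<sigma> k lam x \<eta>) =
      c * (real n * ((k j + real n - 1) * (z ^ (n - 1) * w ^ (m + 1))
                     - (real m + k (j + 1)) * (z ^ n * w ^ m)))"
  \<comment> \<open>On an empty site \<open>move\<close> does nothing and the rate is 0, so both
    sides vanish.\<close>
  proof (cases "n = 0")
    case False
    then have "D' M \<sigma> k lam x (move j (j + 1) \<eta>) = off_bond j M \<sigma> k lam x \<eta> *
        (site_weight (k j) (n - 1) * site_weight (k (j + 1)) (Suc m)) * (z ^ (n - 1) * w ^ (m + 1))"
      unfolding split by (subst off) (auto simp: move_def z_def w_def n_def m_def)
    moreover have "site_weight (k j) (n - 1) = (k j + real n - 1) * site_weight (k j) n"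
      using False assms(2) by (intro site_weight_pred) auto
    ultimately have "(real m + k (j + 1)) * D' M \<sigma> k lam x (move j (j + 1) \<eta>) =
        c * ((k j + real n - 1) * (z ^ (n - 1) * w ^ (m + 1)))"
      \<comment> \<open>Expanding the weight at \<open>m\<close> inside \<open>c\<close> supplies
        the rate factor and the weight at \<open>Suc m\<close> found on the left.\<close>
      unfolding c_def site_weight_Suc[OF assms(3), of m] by (simp only: mult_ac add_ac)
    moreover have "real n * (real m + k (j + 1)) * (D' M \<sigma> k lam x (move j (j + 1) \<eta>) - D' M \<sigma> k lam x \<eta>) =
        real n * ((real m + k (j + 1)) * D' M \<sigma> k lam x (move j (j + 1) \<eta>) - (real m + k (j + 1)) * D' M \<sigma> k lam x \<eta>)"
      by (simp only: right_diff_distrib mult.assoc)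
    ultimately show ?thesis
      unfolding D by (simp only: right_diff_distrib mult_ac)
  qed simp
  show "real m * (real n + k j) *
      (D' M \<sigma> k lam x (move (j + 1) j \<eta>) - D' M \<sigma> k lam x \<eta>) =
      c * (real m * ((k (j + 1) + real m - 1) * (z ^ (n + 1) * w ^ (m - 1))
                     - (real n + k j) * (z ^ n * w ^ m)))"
  proof (cases "m = 0")
    case False
    then have "D' M \<sigma> k lam x (move (j + 1) j \<eta>) = off_bond j M \<sigma> k lam x \<eta> *
        (site_weight (k j) (Suc n) * site_weight (k (j + 1)) (m - 1)) * (z ^ (n + 1) * w ^ (m - 1))"
      unfolding split by (subst off) (auto simp: move_def z_def w_def n_def m_def)
    moreover have "site_weight (k (j + 1)) (m - 1) =
        (k (j + 1) + real m - 1) * site_weight (k (j + 1)) m"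
      using False assms(3) by (intro site_weight_pred) auto
    ultimately have "(real n + k j) * D' M \<sigma> k lam x (move (j + 1) j \<eta>) =
        c * ((k (j + 1) + real m - 1) * (z ^ (n + 1) * w ^ (m - 1)))"
      unfolding c_def site_weight_Suc[OF assms(2), of n] by (simp only: mult_ac add_ac)
    moreover have "real m * (real n + k j) * (D' M \<sigma> k lam x (move (j + 1) j \<eta>) - D' M \<sigma> k lam x \<eta>) =
        real m * ((real n + k j) * D' M \<sigma> k lam x (move (j + 1) j \<eta>) - (real n + k j) * D' M \<sigma> k lam x \<eta>)"
      by (simp only: right_diff_distrib mult.assoc)
    ultimately show ?thesis
      unfolding D by (simp only: right_diff_distrib mult_ac)
  qed simp
qed

section \<open>Duality on each bond and summation\<close>

lemma bond_duality:
  fixes x :: "nat \<Rightarrow> real"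
  assumes "j \<in> {1..M - 1}" and "\<sigma> \<noteq> 0" and "lam > 0" and "k j > 0" and "k (j + 1) > 0"
    and nonneg: "\<And>i. i \<in> {1..M} \<Longrightarrow> x i \<ge> 0"
  shows "ABEP_A \<sigma> lam j x * exch_deriv j (exch_deriv j (\<lambda>y. D' M \<sigma> k lam y \<eta>)) x
       + ABEP_B \<sigma> k lam j x * exch_deriv j (\<lambda>y. D' M \<sigma> k lam y \<eta>) x
     = real (\<eta> j) * (real (\<eta> (j + 1)) + k (j + 1)) *
         (D' M \<sigma> k lam x (move j (j + 1) \<eta>) - D' M \<sigma> k lam x \<eta>)
       + real (\<eta> (j + 1)) * (real (\<eta> j) + k j) *
         (D' M \<sigma> k lam x (move (j + 1) j \<eta>) - D' M \<sigma> k lam x \<eta>)"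
proof -
  define S where "S = sinh_sc \<sigma> (lam + 2 * Eminus j x)"
  define C where "C = cosh_sc \<sigma> (lam + 2 * Eminus j x)"
  define z where "z = energy \<sigma> lam j x"
  define w where "w = energy \<sigma> lam (j + 1) x"
  define n where "n = \<eta> j"
  define m where "m = \<eta> (j + 1)"
  define T where "T y = off_bond j M \<sigma> k lam y \<eta> *
    (site_weight (k j) n * site_weight (k (j + 1)) m)" for y
  have j: "j \<ge> 1" and x: "x j \<ge> 0" "x (j + 1) \<ge> 0"
    using assms(1) by (auto intro!: nonneg)
  \<comment> \<open>With \<lambda> > 0 the argument of sinh in \<open>S\<close> is nonzero, so the
    denominators of A_j and B_j do not vanish.\<close>
  have "Eminus j x \<ge> 0"
    unfolding Eminus_def using assms(1) by (intro sum_nonneg nonneg) auto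
  then have "S \<noteq> 0"
    using assms(2,3) by (simp add: S_def sinh_sc_def)
  note coeffs = ABEP_coeffs_energy[OF j assms(2), of lam x, folded S_def C_def z_def w_def, OF this]
  have T: "has_exch_deriv j T 0 y" for y
    using has_exch_deriv_mult[OF has_exch_deriv_off_bond[OF j assms(2)] has_exch_deriv_const]
    by (simp add: T_def[abs_def])
  have f: "(\<lambda>y. D' M \<sigma> k lam y \<eta>) =
      (\<lambda>y. T y * (energy \<sigma> lam j y ^ n * energy \<sigma> lam (j + 1) y ^ m))"
    unfolding D'_split[OF assms(1)] T_def n_def m_def ..
  define d1 where "d1 = real n * z ^ (n - 1) * w ^ m - real m * z ^ n * w ^ (m - 1)"
  define d2 where "d2 = real n * real (n - 1) * z ^ (n - 2) * w ^ m
        - 2 * real n * real m * z ^ (n - 1) * w ^ (m - 1)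
        + real m * real (m - 1) * z ^ n * w ^ (m - 2)"
  have first: "exch_deriv j (\<lambda>y. D' M \<sigma> k lam y \<eta>) x = 2 * S * T x * d1"
    unfolding f d1_def S_def z_def w_def
    by (rule exch_deriv_eqI[OF has_exch_deriv_bond[OF j assms(2) T] x])
  have second: "exch_deriv j (exch_deriv j (\<lambda>y. D' M \<sigma> k lam y \<eta>)) x =
      4 * \<sigma> * C * T x * d1 + 4 * S\<^sup>2 * T x * d2"
    unfolding f d1_def d2_def S_def C_def z_def w_def
    by (rule exch_deriv_bond2[of j, OF j assms(2) x T])
  \<comment> \<open>Collecting by \<open>d1\<close> and \<open>d2\<close> exposes the two
    coefficient combinations that simplify in energy coordinates.\<close>
  have "ABEP_A \<sigma> lam j x * (4 * \<sigma> * C * T x * d1 + 4 * S\<^sup>2 * T x * d2)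
      + ABEP_B \<sigma> k lam j x * (2 * S * T x * d1)
      = T x * ((4 * S\<^sup>2 * ABEP_A \<sigma> lam j x) * d2
        + (4 * \<sigma> * C * ABEP_A \<sigma> lam j x + 2 * S * ABEP_B \<sigma> k lam j x) * d1)"
    by (simp add: algebra_simps)
  also have "\<dots> = T x * (z * w * d2 + (k j * w - k (j + 1) * z) * d1)"
    unfolding coeffs ..
  finally show ?thesis
    unfolding first second d1_def d2_def BEP_SIP_bond
    unfolding SIP_bond[where \<sigma> = \<sigma> and lam = lam and x = x and \<eta> = \<eta>, OF assms(1,4,5)]
    by (simp only: T_def n_def m_def z_def w_def distrib_left)
qed

theorem theorem4p7:
  fixes \<sigma> lam :: real and M :: nat and k :: "nat \<Rightarrow> real"
  assumes "\<sigma> \<noteq> 0" and "lam > 0" and "M \<ge> 1"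
    and "\<forall>j\<in>{1..M}. k j > 0"
  shows "\<forall>x\<in>Xc M. \<forall>\<eta>\<in>Xd M.
           L_ABEP M \<sigma> k lam (\<lambda>y. D' M \<sigma> k lam y \<eta>) x = L_SIP M k (\<lambda>\<xi>. D' M \<sigma> k lam x \<xi>) \<eta>"
proof (intro ballI)
  fix x \<eta>
  assume "x \<in> Xc M"
  then have "\<And>i. i \<in> {1..M} \<Longrightarrow> x i \<ge> 0"
    unfolding Xc_def by (auto dest: PiE_mem)
  then show "L_ABEP M \<sigma> k lam (\<lambda>y. D' M \<sigma> k lam y \<eta>) x =
      L_SIP M k (\<lambda>\<xi>. D' M \<sigma> k lam x \<xi>) \<eta>"
    \<comment> \<open>Both generators sum over the same bonds, and the identity holds term by
      term.\<close>
    unfolding L_ABEP_def L_SIP_def using assms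
    by (intro sum.cong refl bond_duality) auto
qed

end
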